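(* The following two statements are equivalent. (a) For all $R_+\subseteq U$, $S_+\subseteq F$, $T_+\subseteq C$, $$0\le|R_+|+\sum_{i\in T_+}\Bigl(-\Bigl\lfloor\tfrac{n}{k_0}\Bigr\rfloor+|C_i|\Bigr)+e(U\setminus R_+,S_+)+e(F^C\setminus S_+,T_+)+|U^0|\cdot e(F^0\setminus S_+,T_+).$$ (b) For all $\emptyset\ne T_+\subseteq C$ and all $S_+\subseteq\delta^-(T_+)$ with $S_+\cap F^0=\delta^-(T_+)\cap F^0$, $$\sum_{i\in T_+}\Bigl(\Bigl\lfloor\tfrac{n}{k_0}\Bigr\rfloor-|C_i|\Bigr)\le|R_+|+e(F^C\setminus S_+,T_+),\qquad\text{where } R_+=\{v\in U:\delta^+(v)\cap S_+\ne\emptyset\}.$$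
   Context: Let $G=(V,E)$ be a finite simple graph with $n=|V|$, and let $\Pi_p=(C_1,\dots,C_n)$ be a partial $k$-coloring: pairwise disjoint stable subsets of $V$ with $C_i=\emptyset$ for $i>k$. Let $U=V\setminus\bigcup_i C_i$ be the set of uncolored vertices and, for $v\in U$, let $F(v)=\{1,\dots,n\}\setminus\{i: C_i\text{ contains a neighbor of }v\}$ be its free colors. Let $1\le k_0\le n$. Let $U$ be the disjoint union of $U^0,U^1,\dots,U^l$ ($l\ge1$), where $U^1,\dots,U^l$ are pairwise non-adjacent cliques of $G$ and $U^0$ consists of the remaining uncolored vertices. Define a directed graph with vertex set $U\cup F\cup C$, where $C=\{1,\dots,k_0\}$, $F=\bigcup_{j=0}^l F^j$, and each $F^j=\{f^j(1),\dots,f^j(k_0)\}$ is a separate copy of $C$; put $F^C=\bigcup_{j=1}^l F^j$. Its arcs are $A_2=\bigcup_{j=0}^l\{(v,f^j(i)): v\in U^j,\ i\in F(v),\ 1\le i\le k_0\}$ and $A_3=\bigcup_{j=0}^l\{(f^j(i),i):1\le i\le k_0\}$. For a vertex set $W$, $\delta^+(W)$ is the set of heads of arcs with tail in $W$ (with $\delta^+(v)=\delta^+(\{v\})$) and $\delta^-(W)$ is the set of tails of arcs with head in $W$; $e(W_1,W_2)$ is the number of arcs with tail in $W_1$ and head in $W_2$. *)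

theory Defs
  imports Complex_Main "HOL-Library.Disjoint_Sets" "Graph_Theory.Pair_Digraph"
begin

text \<open>
  A finite simple graph is a \<open>pair_graph\<close>: a finite, loop-free digraph whose arc set is
  symmetric, an edge \<open>uv\<close> being represented by the two arcs \<open>(u, v)\<close> and \<open>(v, u)\<close>.
\<close>

definition stable_in :: "'a pair_pre_digraph \<Rightarrow> 'a set \<Rightarrow> bool" where
  "stable_in G A \<longleftrightarrow> A \<subseteq> pverts G \<and> (\<forall>u\<in>A. \<forall>v\<in>A. (u, v) \<notin> parcs G)"

definition clique_in :: "'a pair_pre_digraph \<Rightarrow> 'a set \<Rightarrow> bool" where
  "clique_in G A \<longleftrightarrow> A \<subseteq> pverts G \<and> (\<forall>u\<in>A. \<forall>v\<in>A. u \<noteq> v \<longrightarrow> (u, v) \<in> parcs G)"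

definition non_adjacent :: "'a pair_pre_digraph \<Rightarrow> 'a set \<Rightarrow> 'a set \<Rightarrow> bool" where
  "non_adjacent G A B \<longleftrightarrow> (\<forall>u\<in>A. \<forall>v\<in>B. (u, v) \<notin> parcs G)"

text \<open>
  The tuple of color classes is a function on the colors \<open>1..n\<close>; its values at other
  indices are never used.
\<close>

definition partial_coloring :: "'a pair_pre_digraph \<Rightarrow> nat \<Rightarrow> (nat \<Rightarrow> 'a set) \<Rightarrow> bool" where
  "partial_coloring G k C \<longleftrightarrow>
     (\<forall>i\<in>{1..card (pverts G)}. stable_in G (C i)) \<and>
     disjoint_family_on C {1..card (pverts G)} \<and>
     (\<forall>i\<in>{1..card (pverts G)}. k < i \<longrightarrow> C i = {})"

definition uncolored :: "'a pair_pre_digraph \<Rightarrow> (nat \<Rightarrow> 'a set) \<Rightarrow> 'a set" where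
  "uncolored G C = pverts G - (\<Union>i\<in>{1..card (pverts G)}. C i)"

definition free_colors :: "'a pair_pre_digraph \<Rightarrow> (nat \<Rightarrow> 'a set) \<Rightarrow> 'a \<Rightarrow> nat set" where
  "free_colors G C v = {1..card (pverts G)} - {i. \<exists>w\<in>C i. (v, w) \<in> parcs G}"

definition clique_decomposition ::
    "'a pair_pre_digraph \<Rightarrow> 'a set \<Rightarrow> nat \<Rightarrow> (nat \<Rightarrow> 'a set) \<Rightarrow> bool" where
  "clique_decomposition G U l P \<longleftrightarrow>
     U = (\<Union>j\<in>{0..l}. P j) \<and> disjoint_family_on P {0..l} \<and>
     (\<forall>j\<in>{1..l}. clique_in G (P j)) \<and>
     (\<forall>i\<in>{1..l}. \<forall>j\<in>{1..l}. i \<noteq> j \<longrightarrow> non_adjacent G (P i) (P j))"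

text \<open>
  \<open>Free j i\<close> is the vertex \<open>f\<^sup>j(i)\<close>; the constructors keep \<open>U\<close>, the copies \<open>F\<^sup>j\<close> and \<open>C\<close>
  pairwise disjoint.
\<close>

datatype 'a node = Vert 'a | Free nat nat | Col nat

definition free_copy :: "nat \<Rightarrow> nat \<Rightarrow> 'a node set" where
  "free_copy k0 j = Free j ` {1..k0}"

definition aux_digraph ::
    "'a pair_pre_digraph \<Rightarrow> (nat \<Rightarrow> 'a set) \<Rightarrow> nat \<Rightarrow> nat \<Rightarrow> (nat \<Rightarrow> 'a set) \<Rightarrow>
     'a node pair_pre_digraph" where
  "aux_digraph G C k0 l P =
     \<lparr> pverts = Vert ` uncolored G C \<union> (\<Union>j\<in>{0..l}. free_copy k0 j) \<union> Col ` {1..k0},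
       parcs =
         (\<Union>j\<in>{0..l}. {(Vert v, Free j i) |v i. v \<in> P j \<and> i \<in> free_colors G C v \<and> i \<in> {1..k0}}) \<union>
         (\<Union>j\<in>{0..l}. {(Free j i, Col i) |i. i \<in> {1..k0}}) \<rparr>"

definition out_nbrs :: "'b pair_pre_digraph \<Rightarrow> 'b set \<Rightarrow> 'b set" where
  "out_nbrs D W = parcs D `` W"

definition in_nbrs :: "'b pair_pre_digraph \<Rightarrow> 'b set \<Rightarrow> 'b set" where
  "in_nbrs D W = (parcs D)\<inverse> `` W"

definition arcs_between :: "'b pair_pre_digraph \<Rightarrow> 'b set \<Rightarrow> 'b set \<Rightarrow> nat" where
  "arcs_between D W1 W2 = card {a \<in> parcs D. fst a \<in> W1 \<and> snd a \<in> W2}"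

end

theory Submission
  imports Defs
begin

text \<open>
  For a pair \<open>S\<close>, \<open>T\<close>, let \<open>R\<close> be the set of uncolored vertices with an arc into \<open>S\<close>.
  This is the choice of \<open>R\<close> for which \<open>e(U - R, S)\<close> vanishes, and \<open>S \<supseteq> \<delta>\<^sup>-(T) \<inter> F\<^sup>0\<close> makes
  \<open>e(F\<^sup>0 - S, T)\<close> vanish. So (b) is (a) restricted to special triples.

  These triples are the worst ones. Given arbitrary \<open>R\<close>, \<open>S\<close>, \<open>T\<close>, replace \<open>S\<close> by
  \<open>S' = \<delta>\<^sup>-(T) \<inter> (S \<union> F\<^sup>0)\<close>, which does not change \<open>e(F\<^sup>C - S, T)\<close>, and \<open>R\<close> by the set \<open>R'\<close>
  of vertices with an arc into \<open>S'\<close>. A vertex of \<open>R' - R\<close> either sends an arc into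
  \<open>S\<close>, and is paid for by that arc in \<open>e(U - R, S)\<close>; or it sends one into
  \<open>\<delta>\<^sup>-(T) \<inter> F\<^sup>0 - S\<close>. In the second case it lies in \<open>U\<^sup>0\<close>, since only \<open>U\<^sup>0\<close> has arcs to \<open>F\<^sup>0\<close>,
  and \<open>e(F\<^sup>0 - S, T) \<ge> 1\<close>, so the weight \<open>|U\<^sup>0|\<close> pays for all such vertices at once. Hence
  \<open>|R'| \<le> |R| + e(U - R, S) + |U\<^sup>0| e(F\<^sup>0 - S, T)\<close> (lemma \<open>card_tails_exchange\<close>), and (b) for
  \<open>S'\<close>, \<open>T\<close> yields (a) for \<open>R\<close>, \<open>S\<close>, \<open>T\<close>. When \<open>T\<close> is empty, (a) has only nonnegative terms.
\<close>

lemma arcs_between_eq_0_iff: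
  assumes "finite (parcs D)"
  shows "arcs_between D A B = 0 \<longleftrightarrow> (\<forall>x\<in>A. \<forall>y\<in>B. (x, y) \<notin> parcs D)"
proof -
  have "finite {a \<in> parcs D. fst a \<in> A \<and> snd a \<in> B}"
    using assms by simp
  then show ?thesis
    unfolding arcs_between_def by auto
qed

lemma arcs_between_cong_in_nbrs:
  assumes "A \<inter> in_nbrs D B = A' \<inter> in_nbrs D B"
  shows "arcs_between D A B = arcs_between D A' B"
proof -
  have "{a \<in> parcs D. fst a \<in> A \<and> snd a \<in> B} = {a \<in> parcs D. fst a \<in> A' \<and> snd a \<in> B}"
    using assms unfolding in_nbrs_def set_eq_iff by fastforce
  then show ?thesis
    unfolding arcs_between_def by simp
qed

lemma card_tails_le_arcs_between:
  assumes "finite (parcs D)"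
  shows "card {x \<in> A. out_nbrs D {x} \<inter> B \<noteq> {}} \<le> arcs_between D A B"
proof -
  let ?E = "{a \<in> parcs D. fst a \<in> A \<and> snd a \<in> B}"
  have "{x \<in> A. out_nbrs D {x} \<inter> B \<noteq> {}} \<subseteq> fst ` ?E"
    unfolding out_nbrs_def by force
  then show ?thesis
    unfolding arcs_between_def using assms by (intro surj_card_le) auto
qed

text \<open>
  Enlarging \<open>S\<close> by the vertices of \<open>F0\<close> that have an arc into \<open>T\<close> adds tails only
  inside \<open>X\<close>, and adds none unless some vertex of \<open>F0 - S\<close> has an arc into \<open>T\<close>. That one arc,
  weighted by the size of \<open>X\<close>, covers all added tails together.
\<close>

lemma card_tails_exchange:
  fixes D :: "'b pair_pre_digraph"
  assumes fin: "finite (parcs D)" "finite W" "finite X"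
    and X: "\<And>x y. x \<in> W \<Longrightarrow> y \<in> F0 \<Longrightarrow> (x, y) \<in> parcs D \<Longrightarrow> x \<in> X"
    and R: "R \<subseteq> W"
  shows "card {x \<in> W. out_nbrs D {x} \<inter> (in_nbrs D T \<inter> (S \<union> F0)) \<noteq> {}}
    \<le> card R + arcs_between D (W - R) S + card X * arcs_between D (F0 - S) T"
    (is "card ?R' \<le> _")
proof -
  define Y where "Y = {x \<in> W - R. out_nbrs D {x} \<inter> S \<noteq> {}}"
  define Z where "Z = (if arcs_between D (F0 - S) T = 0 then {} else X)"
  have "?R' \<subseteq> R \<union> Y \<union> Z"
  proof
    fix x
    assume "x \<in> ?R'"
    then obtain y t where x: "x \<in> W" and xy: "(x, y) \<in> parcs D" and yt: "(y, t) \<in> parcs D"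
      and t: "t \<in> T" and y: "y \<in> S \<union> F0"
      unfolding out_nbrs_def in_nbrs_def by auto
    show "x \<in> R \<union> Y \<union> Z"
    proof (cases "y \<in> S")
      case True
      then show ?thesis
        using x xy unfolding Y_def out_nbrs_def by auto
    next
      case False
      then have "y \<in> F0 - S"
        using y by simp
      then have "arcs_between D (F0 - S) T \<noteq> 0"
        using fin(1) yt t by (auto simp: arcs_between_eq_0_iff)
      then show ?thesis
        using X[OF x _ xy] \<open>y \<in> F0 - S\<close> unfolding Z_def by simp
    qed
  qed
  moreover have "finite (R \<union> Y \<union> Z)"
    using fin R unfolding Y_def Z_def by (auto intro: finite_subset)
  ultimately have "card ?R' \<le> card (R \<union> Y \<union> Z)"
    by (rule card_mono[rotated])
  also have "\<dots> \<le> card R + card Y + card Z"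
    using card_Un_le[of "R \<union> Y" Z] card_Un_le[of R Y] by linarith
  also have "\<dots> \<le> card R + arcs_between D (W - R) S + card X * arcs_between D (F0 - S) T"
  proof -
    have "card Y \<le> arcs_between D (W - R) S"
      unfolding Y_def by (rule card_tails_le_arcs_between[OF fin(1)])
    moreover have "card Z \<le> card X * arcs_between D (F0 - S) T"
      unfolding Z_def by simp
    ultimately show ?thesis
      by linarith
  qed
  finally show ?thesis .
qed

lemma finite_parcs_aux_digraph:
  assumes "\<And>j. j \<in> {0..l} \<Longrightarrow> finite (P j)"
  shows "finite (parcs (aux_digraph G C k0 l P))"
proof -
  have "parcs (aux_digraph G C k0 l P) \<subseteq>
      (\<Union>j\<in>{0..l}. (Vert ` P j \<times> free_copy k0 j) \<union> (free_copy k0 j \<times> Col ` {1..k0}))"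
    unfolding aux_digraph_def free_copy_def by auto
  moreover have "finite \<dots>"
    using assms unfolding free_copy_def by auto
  ultimately show ?thesis
    by (rule finite_subset)
qed

lemma in_nbrs_Col_aux_digraph:
  "in_nbrs (aux_digraph G C k0 l P) (Col ` T) \<subseteq> (\<Union>j\<in>{0..l}. free_copy k0 j)"
  unfolding in_nbrs_def aux_digraph_def free_copy_def by auto

lemma aux_digraph_arc_to_free_copy:
  assumes "(Vert v, y) \<in> parcs (aux_digraph G C k0 l P)" and "y \<in> free_copy k0 j"
  shows "v \<in> P j"
  using assms unfolding aux_digraph_def free_copy_def by auto

theorem mainTheorem7:
  fixes G :: "'a pair_pre_digraph" and C P :: "nat \<Rightarrow> 'a set" and k k0 l n :: nat
    and U :: "'a set" and D :: "'a node pair_pre_digraph" and F F0 FC :: "'a node set"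
  assumes "pair_graph G"
    and "n = card (pverts G)"
    and "partial_coloring G k C"
    and "U = uncolored G C"
    and "1 \<le> k0" and "k0 \<le> n"
    and "1 \<le> l"
    and "clique_decomposition G U l P"
    and "D = aux_digraph G C k0 l P"
    and "F = (\<Union>j\<in>{0..l}. free_copy k0 j)"
    and "F0 = free_copy k0 0"
    and "FC = (\<Union>j\<in>{1..l}. free_copy k0 j)"
  shows
    "(\<forall>R S T. R \<subseteq> U \<and> S \<subseteq> F \<and> T \<subseteq> {1..k0} \<longrightarrow>
        0 \<le> int (card R) + (\<Sum>i\<in>T. - \<lfloor>real n / real k0\<rfloor> + int (card (C i)))
            + int (arcs_between D (Vert ` (U - R)) S)
            + int (arcs_between D (FC - S) (Col ` T))
            + int (card (P 0)) * int (arcs_between D (F0 - S) (Col ` T)))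
     \<longleftrightarrow>
     (\<forall>T S. T \<noteq> {} \<and> T \<subseteq> {1..k0} \<and> S \<subseteq> in_nbrs D (Col ` T)
          \<and> S \<inter> F0 = in_nbrs D (Col ` T) \<inter> F0 \<longrightarrow>
        (let R = {v \<in> U. out_nbrs D {Vert v} \<inter> S \<noteq> {}} in
          (\<Sum>i\<in>T. \<lfloor>real n / real k0\<rfloor> - int (card (C i)))
            \<le> int (card R) + int (arcs_between D (FC - S) (Col ` T))))"
  (is "?a \<longleftrightarrow> ?b")
proof -
  have "finite U"
    using pair_fin_digraph.pair_finite_verts[OF pair_digraph.axioms(1)[OF pair_graph.axioms(1)[OF assms(1)]]]
      assms(4)
    unfolding uncolored_def by simp
  have P_sub: "P j \<subseteq> U" if "j \<in> {0..l}" for j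
    using assms(8) that unfolding clique_decomposition_def by auto
  have finP: "finite (P j)" if "j \<in> {0..l}" for j
    using P_sub[OF that] \<open>finite U\<close> by (rule finite_subset)
  have finD: "finite (parcs D)"
    unfolding \<open>D = _\<close> using finP by (rule finite_parcs_aux_digraph)
  define d where "d i = \<lfloor>real n / real k0\<rfloor> - int (card (C i))" for i
  have sum_neg: "(\<Sum>i\<in>T. - \<lfloor>real n / real k0\<rfloor> + int (card (C i))) = - sum d T" for T
    unfolding d_def sum_negf[symmetric] by (rule sum.cong) auto
  have disj: "FC \<inter> F0 = {}"
    unfolding assms(11,12) free_copy_def by auto
  show ?thesis
  proof
    assume a: ?a
    show ?b
      unfolding Let_def d_def[symmetric]
    proof (intro allI impI, elim conjE)
      fix T S
      assume T: "T \<subseteq> {1..k0}" and S: "S \<subseteq> in_nbrs D (Col ` T)"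
        and S0: "S \<inter> F0 = in_nbrs D (Col ` T) \<inter> F0"
      define R where "R = {v \<in> U. out_nbrs D {Vert v} \<inter> S \<noteq> {}}"
      have "S \<subseteq> F"
        using S in_nbrs_Col_aux_digraph unfolding assms(9,10) by (rule subset_trans)
      moreover have "R \<subseteq> U"
        unfolding R_def by auto
      moreover have "arcs_between D (Vert ` (U - R)) S = 0"
        unfolding arcs_between_eq_0_iff[OF finD] R_def out_nbrs_def by auto
      moreover have "arcs_between D (F0 - S) (Col ` T) = 0"
        using S0 unfolding arcs_between_eq_0_iff[OF finD] in_nbrs_def by auto
      ultimately have "0 \<le> int (card R) - sum d T + int (arcs_between D (FC - S) (Col ` T))"
        using a[rule_format, of R S T] T unfolding sum_neg by simp
      then show "sum d T \<le> int (card R) + int (arcs_between D (FC - S) (Col ` T))"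
        by linarith
    qed
  next
    assume b: ?b
    show ?a
      unfolding sum_neg
    proof (intro allI impI, elim conjE)
      fix R S T
      assume R: "R \<subseteq> U" and T: "T \<subseteq> {1..k0}"
      define S' where "S' = in_nbrs D (Col ` T) \<inter> (S \<union> F0)"
      define R' where "R' = {v \<in> U. out_nbrs D {Vert v} \<inter> S' \<noteq> {}}"
      show "0 \<le> int (card R) + - sum d T + int (arcs_between D (Vert ` (U - R)) S)
          + int (arcs_between D (FC - S) (Col ` T))
          + int (card (P 0)) * int (arcs_between D (F0 - S) (Col ` T))"
      proof (cases "T = {}")
        case True
        then show ?thesis
          by simp
      next
        case False
        have "S' \<subseteq> in_nbrs D (Col ` T)" "S' \<inter> F0 = in_nbrs D (Col ` T) \<inter> F0"
          unfolding S'_def by auto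
        then have "sum d T \<le> int (card R') + int (arcs_between D (FC - S') (Col ` T))"
          using b[unfolded Let_def, folded d_def, rule_format, of T S'] False T
          unfolding R'_def by simp
        moreover have "arcs_between D (FC - S') (Col ` T) = arcs_between D (FC - S) (Col ` T)"
          by (rule arcs_between_cong_in_nbrs) (use disj in \<open>auto simp: S'_def\<close>)
        moreover have "card R' \<le> card R + arcs_between D (Vert ` (U - R)) S
            + card (P 0) * arcs_between D (F0 - S) (Col ` T)"
        proof -
          have inj: "inj_on Vert A" for A :: "'a set"
            by (simp add: inj_on_def)
          have diff: "Vert ` U - Vert ` R = Vert ` (U - R)"
            by auto
          have R'_img: "Vert ` R' = {x \<in> Vert ` U. out_nbrs D {x} \<inter> S' \<noteq> {}}"
            unfolding R'_def by auto
          have "card {x \<in> Vert ` U. out_nbrs D {x} \<inter> S' \<noteq> {}}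
              \<le> card (Vert ` R) + arcs_between D (Vert ` U - Vert ` R) S
                + card (Vert ` P 0) * arcs_between D (F0 - S) (Col ` T)"
            unfolding S'_def
            by (rule card_tails_exchange)
              (use finD finP \<open>finite U\<close> R in
                \<open>auto simp: assms(9,11) dest: aux_digraph_arc_to_free_copy\<close>)
          then show ?thesis
            unfolding R'_img[symmetric] diff card_image[OF inj] .
        qed
        then have "int (card R') \<le> int (card R) + int (arcs_between D (Vert ` (U - R)) S)
            + int (card (P 0)) * int (arcs_between D (F0 - S) (Col ` T))"
          by (simp flip: of_nat_add of_nat_mult)
        ultimately show ?thesis
          by linarith
      qed
    qed
  qed
qed

end
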